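(* Let $a=(a_n)_{n=0}^\infty$ with $a_n=(n+1)!$ (the factoradic numeral system), and let $d=(d_n)_{n=0}^\infty$ with $d_n=(n+1)!+n!$. Then $d$ is a divisor system for $a$, and for every integer $n\geq 1$ and $$q:=\left(B(n+1,1),B(n+1,2),\ldots,B(n+1,n)\right)\in\mathbb{Z}_{>0}^n,$$ the simplex $\Delta_{(1,q)}\subset\mathbb{R}^n$ is reflexive and has $h^\ast$-polynomial $$h^\ast(\Delta_{(1,q)};z)=A_{n+1}(z).$$
   Context: A numeral system is a sequence of positive integers $a=(a_n)_{n=0}^\infty$ with $a_0=1<a_1<a_2<\cdots$. A divisor system for $a$ is an increasing sequence of positive integers $d=(d_n)_{n=0}^\infty$ such that (1) $d_i\mid a_n$ for all $n\geq1$ and $0\leq i\leq n-1$, and (2) $1+\sum_{i=0}^{n-1}\frac{a_n}{d_i}=a_n$ for all $n\geq 1$. For a permutation $\pi=\pi_1\pi_2\cdots\pi_n\in S_n$ of $[n]=\{1,\ldots,n\}$ let $\mathrm{Des}(\pi)=\{i\in[n-1]:\pi_i>\pi_{i+1}\}$, $\mathrm{des}(\pi)=|\mathrm{Des}(\pi)|$, and let $\mathrm{maxDes}(\pi)=\max \mathrm{Des}(\pi)$ if $\pi\neq 12\cdots n$ and $\mathrm{maxDes}(12\cdots n)=0$. Let $A_n(z)=\sum_{\pi\in S_n}z^{\mathrm{des}(\pi)}$ (the $n$th Eulerian polynomial) and $B_n(z)=\sum_{\pi\in S_n}z^{\mathrm{maxDes}(\pi)}$, and let $B(n,k)$ be the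 coefficient of $z^k$ in $B_n(z)$. For a weakly increasing sequence $q=(q_1,\ldots,q_n)$ of positive integers, $\Delta_{(1,q)}:=\mathrm{conv}(e_1,\ldots,e_n,-q)\subset\mathbb{R}^n$, where $e_1,\ldots,e_n$ are the standard basis vectors. A lattice polytope $P\subset\mathbb{R}^n$ (all vertices in $\mathbb{Z}^n$) is reflexive if its polar body $P^\circ=\{y\in\mathbb{R}^n: y^Tx\leq 1\text{ for all }x\in P\}$ is also a lattice polytope. For a $d$-dimensional lattice polytope $P\subset\mathbb{R}^n$, the $h^\ast$-polynomial $h^\ast(P;z)=h_0^\ast+h_1^\ast z+\cdots+h_d^\ast z^d$ is defined by $\sum_{t\geq0}|tP\cap\mathbb{Z}^n|z^t=\frac{h^\ast(P;z)}{(1-z)^{d+1}}$. *)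

theory Defs
  imports "HOL-Analysis.Analysis" "HOL-Computational_Algebra.Computational_Algebra"
    "HOL-Combinatorics.Permutations"
begin

subsection \<open>Numeral systems and divisor systems\<close>

definition numeral_system :: "(nat \<Rightarrow> nat) \<Rightarrow> bool" where
  "numeral_system a \<longleftrightarrow> a 0 = 1 \<and> strict_mono a"

text \<open>The divisibility condition makes \<open>a n div d i\<close> below the exact quotient.\<close>

definition divisor_system :: "(nat \<Rightarrow> nat) \<Rightarrow> (nat \<Rightarrow> nat) \<Rightarrow> bool" where
  "divisor_system a d \<longleftrightarrow>
     strict_mono d \<and> (\<forall>i. 0 < d i) \<and>
     (\<forall>n\<ge>1. \<forall>i<n. d i dvd a n) \<and>
     (\<forall>n\<ge>1. 1 + (\<Sum>i<n. a n div d i) = a n)"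

subsection \<open>Descent statistics\<close>

definition Des :: "nat \<Rightarrow> (nat \<Rightarrow> nat) \<Rightarrow> nat set" where
  "Des n \<pi> = {i \<in> {1..<n}. \<pi> i > \<pi> (i + 1)}"

definition des :: "nat \<Rightarrow> (nat \<Rightarrow> nat) \<Rightarrow> nat" where
  "des n \<pi> = card (Des n \<pi>)"

definition maxDes :: "nat \<Rightarrow> (nat \<Rightarrow> nat) \<Rightarrow> nat" where
  "maxDes n \<pi> = (if \<pi> = id then 0 else Max (Des n \<pi>))"

definition eulerian_poly :: "nat \<Rightarrow> int poly" where
  "eulerian_poly n = (\<Sum>\<pi> | \<pi> permutes {1..n}. monom 1 (des n \<pi>))"

definition maxDes_poly :: "nat \<Rightarrow> int poly" where
  "maxDes_poly n = (\<Sum>\<pi> | \<pi> permutes {1..n}. monom 1 (maxDes n \<pi>))"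

definition maxDes_number :: "nat \<Rightarrow> nat \<Rightarrow> int" where
  "maxDes_number n k = coeff (maxDes_poly n) k"

subsection \<open>Lattice polytopes\<close>

definition integer_lattice :: "(real ^ 'n) set" where
  "integer_lattice = {x. \<forall>i. x $ i \<in> \<int>}"

definition lattice_polytope :: "(real ^ 'n) set \<Rightarrow> bool" where
  "lattice_polytope P \<longleftrightarrow> polytope P \<and> {v. v extreme_point_of P} \<subseteq> integer_lattice"

definition polar :: "(real ^ 'n) set \<Rightarrow> (real ^ 'n) set" where
  "polar P = {y. \<forall>x\<in>P. y \<bullet> x \<le> 1}"

definition reflexive_polytope :: "(real ^ 'n) set \<Rightarrow> bool" where
  "reflexive_polytope P \<longleftrightarrow> lattice_polytope P \<and> lattice_polytope (polar P)"

definition ehrhart_series :: "(real ^ 'n) set \<Rightarrow> int fps" where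
  "ehrhart_series P =
     Abs_fps (\<lambda>t. int (card ((*\<^sub>R) (real t) ` P \<inter> integer_lattice)))"

text \<open>
  The equation \<open>Ehr(P; z) = h(z) / (1 - z)\<^sup>d\<^sup>+\<^sup>1\<close>, with \<open>d\<close> the dimension of \<open>P\<close>, cleared of
  its denominator, which is a unit in the ring of formal power series over the integers.
\<close>

definition has_hstar_poly :: "(real ^ 'n) set \<Rightarrow> int poly \<Rightarrow> bool" where
  "has_hstar_poly P h \<longleftrightarrow>
     degree h \<le> nat (aff_dim P) \<and>
     ehrhart_series P * (1 - fps_X) ^ (nat (aff_dim P) + 1) = fps_of_poly h"

lemma has_hstar_poly_unique:
  assumes "has_hstar_poly P g" and "has_hstar_poly P h"
  shows "g = h"
  using assms unfolding has_hstar_poly_def by (metis fps_of_poly_eq_iff)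

subsection \<open>The simplices\<close>

definition Delta1 :: "int ^ 'n \<Rightarrow> (real ^ 'n) set" where
  "Delta1 q = convex hull (insert (- (\<chi> i. of_int (q $ i))) (range (\<lambda>i. axis i 1)))"

text \<open>
  Coordinates of \<open>\<real>\<^sup>n\<close> are indexed by a finite linearly ordered type with \<open>n\<close> elements; the
  linear order identifies this type with \<open>{1..n}\<close>, the index \<open>i\<close> having position \<open>card {..i}\<close>.
\<close>

definition coord_pos :: "'n::{finite,linorder} \<Rightarrow> nat" where
  "coord_pos i = card {..i}"

definition maxDes_vector :: "int ^ 'n::{finite,linorder}" where
  "maxDes_vector = (\<chi> i. maxDes_number (CARD('n) + 1) (coord_pos i))"

end

theory Submission
  imports Defs "HOL-Combinatorics.Multiset_Permutations"
begin

text \<open>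
  Put \<open>N = 1 + q\<^sub>1 + \<dots> + q\<^sub>n\<close>. A point \<open>x\<close> of \<open>t\<Delta>\<close> has barycentric weight
  \<open>s / N\<close> at the vertex \<open>-q\<close>, where \<open>s = t - \<Sum>x\<^sub>i\<close>, and \<open>x\<^sub>i + \<lfloor>q\<^sub>i s / N\<rfloor>\<close> may be any natural
  number for lattice points. Since \<open>\<omega>(s) = s - \<Sum>\<lfloor>q\<^sub>i s / N\<rfloor>\<close> satisfies \<open>\<omega>(s + N) = \<omega>(s) + 1\<close>, the
  \<open>h\<^sup>*\<close>-polynomial is the sum of \<open>z\<^bsup>\<omega>(b)\<^esup>\<close> over \<open>b < N\<close>. The polar of \<open>\<Delta>\<close> has the vertices
  \<open>(1,\<dots>,1)\<close> and \<open>(1,\<dots>,1) - (N / q\<^sub>i) e\<^sub>i\<close>, which are integral because \<open>q\<^sub>i\<close> divides \<open>N\<close>.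

  Permutations of \<open>{1..n+1}\<close> that increase after position \<open>k\<close> number \<open>(n+1)! / (n+1-k)!\<close>, whence
  \<open>q\<^sub>k = (n+1)! / d\<^bsub>n-k\<^esub>\<close>, \<open>N = (n+1)!\<close> and \<open>\<omega>(b) = b - \<Sum>\<lfloor>b / d\<^sub>i\<rfloor>\<close>. Prepending a factoradic
  digit \<open>c\<close> to \<open>b\<close> raises \<open>\<omega>\<close> by one exactly if \<open>c\<close> exceeds the next digit, just as prepending a
  letter to a permutation creates a descent exactly if the new leading Lehmer code digit exceeds
  the next one. So \<open>\<omega>\<close> is distributed over \<open>b < (n+1)!\<close> like the number of descents.
\<close>

unbundle no fps_syntax

subsection \<open>The simplices and their polars\<close>

lemma sum_option: "(\<Sum>k\<in>(UNIV::'n::finite option set). f k) = f None + (\<Sum>i\<in>UNIV. f (Some i))"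
  by (simp add: UNIV_option_conv sum.reindex)

text \<open>The weights are indexed by \<open>'n option\<close>, with \<open>None\<close> for
  \<open>v\<close>, so coinciding points cause no trouble.\<close>

lemma convex_hull_insert_rangeI:
  fixes y :: "'n::finite \<Rightarrow> 'a::real_vector"
  assumes "0 \<le> a" "\<And>i. 0 \<le> b i" "a + (\<Sum>i\<in>UNIV. b i) = 1"
  shows "a *\<^sub>R v + (\<Sum>i\<in>UNIV. b i *\<^sub>R y i) \<in> convex hull (insert v (range y))"
proof -
  let ?c = "case_option a b" and ?y = "case_option v y"
  have "(\<Sum>k\<in>UNIV. ?c k *\<^sub>R ?y k) \<in> convex hull (insert v (range y))"
  proof (rule convex_sum)
    show "sum ?c UNIV = 1" using assms(3) by (simp add: sum_option)
    show "0 \<le> ?c k" for k using assms by (cases k) auto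
    show "?y k \<in> convex hull (insert v (range y))" for k
      by (rule hull_inc) (cases k; simp)
  qed auto
  then show ?thesis by (simp add: sum_option)
qed

text \<open>The coordinate sum is 1 at every \<open>axis i 1\<close> and \<open>1 - N\<close> at
  \<open>-q\<close>, so the barycentric weight of \<open>x\<close> at \<open>-q\<close> has to be
  \<open>(1 - sum x) / N\<close>. The conditions say that this weight and the remaining ones,
  multiplied by \<open>N\<close>, are nonnegative.\<close>

lemma Delta1_iff:
  fixes q :: "int ^ 'n"
  assumes q: "\<And>i. 0 < q $ i" and N: "N = 1 + (\<Sum>i\<in>UNIV. q $ i)"
  shows "x \<in> Delta1 q \<longleftrightarrow>
    (\<Sum>i\<in>UNIV. x $ i) \<le> 1 \<and>
    (\<forall>i. 0 \<le> of_int N * x $ i + (1 - (\<Sum>j\<in>UNIV. x $ j)) * of_int (q $ i))"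
proof -
  have N0: "0 < N" unfolding N using q by (smt (verit) sum_nonneg)
  \<comment> \<open>As an intersection of half-spaces \<open>C\<close> is convex, so one inclusion
    need only be checked at the vertices.\<close>
  define C :: "(real ^ 'n) set" where
    "C = {x. (\<chi> i. 1) \<bullet> x \<le> 1} \<inter>
      (\<Inter>i. {x. (of_int N *\<^sub>R axis i 1 - (\<chi> j. of_int (q $ i))) \<bullet> x \<ge> - of_int (q $ i)})"
  have C_iff: "x \<in> C \<longleftrightarrow>
    (\<Sum>i\<in>UNIV. x $ i) \<le> 1 \<and>
    (\<forall>i. 0 \<le> of_int N * x $ i + (1 - (\<Sum>j\<in>UNIV. x $ j)) * of_int (q $ i))" for x
    unfolding C_def
    by (simp add: inner_diff_left inner_axis' inner_vec_def[of "vec_lambda _"]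
          flip: sum_distrib_left) (simp add: algebra_simps)
  have "convex C" unfolding C_def
    by (intro convex_Int convex_INT convex_halfspace_le convex_halfspace_ge)
  moreover have "axis i 1 \<in> C" for i
    using N0 by (simp add: C_iff axis_def)
  moreover have "- (\<chi> i. of_int (q $ i)) \<in> C"
  proof -
    have "(\<Sum>i\<in>UNIV. real_of_int (q $ i)) = of_int N - 1" unfolding N by simp
    then show ?thesis using N0 by (simp add: C_iff sum_negf)
  qed
  ultimately have "Delta1 q \<subseteq> C"
    unfolding Delta1_def by (intro hull_minimal) auto
  moreover have "x \<in> Delta1 q" if "x \<in> C" for x
  proof -
    define a where "a = (1 - (\<Sum>j\<in>UNIV. x $ j)) / of_int N"
    define b where "b i = x $ i + a * of_int (q $ i)" for i
    have "0 \<le> a" using that N0 by (simp add: a_def C_iff)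
    moreover have "0 \<le> b i" for i
    proof -
      have "of_int N * b i = of_int N * x $ i + (1 - (\<Sum>j\<in>UNIV. x $ j)) * of_int (q $ i)"
        using N0 by (simp add: a_def b_def field_simps)
      then have "0 \<le> of_int N * b i" using that by (simp add: C_iff)
      then show ?thesis using N0 by (simp add: zero_le_mult_iff)
    qed
    moreover have "a + (\<Sum>i\<in>UNIV. b i) = 1"
    proof -
      have "a + (\<Sum>i\<in>UNIV. b i) = (\<Sum>j\<in>UNIV. x $ j) + a * of_int N"
        by (simp add: b_def sum.distrib N algebra_simps flip: sum_distrib_left)
      then show ?thesis using N0 by (simp add: a_def)
    qed
    ultimately have "a *\<^sub>R - (\<chi> i. of_int (q $ i)) + (\<Sum>i\<in>UNIV. b i *\<^sub>R axis i 1) \<in> Delta1 q"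
      unfolding Delta1_def by (rule convex_hull_insert_rangeI)
    moreover have "a *\<^sub>R - (\<chi> i. of_int (q $ i)) + (\<Sum>i\<in>UNIV. b i *\<^sub>R axis i 1) = x"
      by (simp add: vec_eq_iff b_def axis_def if_distrib cong: if_cong)
    ultimately show ?thesis by simp
  qed
  ultimately show ?thesis using C_iff by blast
qed

lemma scaled_Delta1_iff:
  fixes q :: "int ^ 'n"
  assumes q: "\<And>i. 0 < q $ i" and N: "N = 1 + (\<Sum>i\<in>UNIV. q $ i)" and t: "0 \<le> t"
  shows "x \<in> (*\<^sub>R) t ` Delta1 q \<longleftrightarrow>
    (\<Sum>i\<in>UNIV. x $ i) \<le> t \<and>
    (\<forall>i. 0 \<le> of_int N * x $ i + (t - (\<Sum>j\<in>UNIV. x $ j)) * of_int (q $ i))"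
    (is "_ \<longleftrightarrow> ?R x")
proof (cases "t = 0")
  case True
  have N0: "0 < N" unfolding N using q by (smt (verit) sum_nonneg)
  \<comment> \<open>Rescaling by \<open>1 / t\<close> is impossible here. For \<open>t = 0\<close>
    the inequalities for all \<open>i\<close> add up to a nonnegative coordinate sum, while the
    first condition makes it nonpositive.\<close>
  have "x = 0" if R: "?R x"
  proof -
    let ?S = "\<Sum>j\<in>UNIV. x $ j"
    have "0 \<le> (\<Sum>i\<in>UNIV. of_int N * x $ i + (t - ?S) * of_int (q $ i))"
      using R by (intro sum_nonneg) auto
    also have "\<dots> = of_int N * ?S - ?S * (of_int N - 1)"
      using True by (simp add: sum.distrib N sum_subtractf flip: sum_distrib_left)
    finally have S: "?S = 0" using R True by (simp add: algebra_simps)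
    then have "\<And>i. 0 \<le> x $ i" using R True N0 by (simp add: zero_le_mult_iff)
    then show ?thesis using S by (simp add: sum_nonneg_eq_0_iff vec_eq_iff)
  qed
  moreover have "Delta1 q \<noteq> {}" by (simp add: Delta1_def)
  ultimately show ?thesis using True by (auto simp: image_iff)
next
  case False
  then have t0: "0 < t" using t by simp
  have "x \<in> (*\<^sub>R) t ` Delta1 q \<longleftrightarrow> (1 / t) *\<^sub>R x \<in> Delta1 q"
  proof
    assume "(1 / t) *\<^sub>R x \<in> Delta1 q"
    then have "t *\<^sub>R (1 / t) *\<^sub>R x \<in> (*\<^sub>R) t ` Delta1 q" by blast
    then show "x \<in> (*\<^sub>R) t ` Delta1 q" using False by simp
  qed (use False in auto)
  also have "\<dots> \<longleftrightarrow> ?R x"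
  proof -
    have S: "(\<Sum>i\<in>UNIV. ((1 / t) *\<^sub>R x) $ i) = (\<Sum>i\<in>UNIV. x $ i) / t"
      by (simp add: sum_divide_distrib)
    have "of_int N * ((1 / t) *\<^sub>R x) $ i + (1 - (\<Sum>j\<in>UNIV. x $ j) / t) * of_int (q $ i)
        = (of_int N * x $ i + (t - (\<Sum>j\<in>UNIV. x $ j)) * of_int (q $ i)) / t" for i
      using t0 by (simp add: field_simps)
    then show ?thesis
      unfolding Delta1_iff[OF q N] S using t0 by (simp add: zero_le_divide_iff)
  qed
  finally show ?thesis .
qed

text \<open>In an affine dependency with coefficient \<open>c\<close> at \<open>-q\<close>,
  coordinate \<open>i\<close> forces the coefficient \<open>c * q_i\<close> at
  \<open>axis i 1\<close>. The coefficients add up to \<open>c * (1 + sum q) = 0\<close>, whence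
  \<open>c = 0\<close>.\<close>

lemma Delta1_simplex:
  fixes q :: "int ^ 'n"
  assumes q: "\<And>i. 0 < q $ i"
  shows "int CARD('n) simplex Delta1 q"
proof -
  define v :: "real ^ 'n" where "v = - (\<chi> i. of_int (q $ i))"
  let ?E = "range (\<lambda>i. axis i (1::real)) :: (real ^ 'n) set"
  have inj: "inj (\<lambda>i. axis i (1::real) :: real ^ 'n)"
    by (rule injI) (simp add: axis_eq_axis)
  have v: "v \<notin> ?E"
  proof
    assume "v \<in> ?E"
    then obtain i where "v = axis i 1" by auto
    then have "v $ i = 1" by simp
    with q[of i] show False by (simp add: v_def)
  qed
  have "\<not> affine_dependent (insert v ?E)"
  proof
    assume "affine_dependent (insert v ?E)"
    then obtain U where U: "sum U (insert v ?E) = 0" "\<exists>w\<in>insert v ?E. U w \<noteq> 0"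
      "(\<Sum>w\<in>insert v ?E. U w *\<^sub>R w) = 0"
      by (subst (asm) affine_dependent_explicit_finite) auto
    let ?u = "\<lambda>i. U (axis i 1)"
    have s: "U v + (\<Sum>i\<in>UNIV. ?u i) = 0"
      using U(1) v by (simp add: sum.reindex[OF inj])
    have "U v *\<^sub>R v + (\<Sum>i\<in>UNIV. ?u i *\<^sub>R axis i 1) = 0"
      using U(3) v by (simp add: sum.reindex[OF inj])
    then have u: "?u i = U v * of_int (q $ i)" for i
      by (simp add: vec_eq_iff v_def axis_def if_distrib cong: if_cong)
    have "U v * (1 + (\<Sum>i\<in>UNIV. of_int (q $ i))) = 0"
      using s by (simp add: u algebra_simps sum_distrib_left)
    moreover have "0 < 1 + (\<Sum>i\<in>UNIV. real_of_int (q $ i))"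
      using q by (smt (verit) sum_nonneg of_int_0_less_iff)
    ultimately have "U v = 0" by simp
    with U(2) u show False by auto
  qed
  moreover have "card (insert v ?E) = CARD('n) + 1"
    using v by (simp add: card_image[OF inj])
  ultimately show ?thesis
    unfolding simplex Delta1_def v_def[symmetric]
    by (intro exI[of _ "insert v ?E"]) auto
qed

lemma lattice_polytope_convex_hull:
  assumes "finite V" "V \<subseteq> integer_lattice"
  shows "lattice_polytope (convex hull V)"
  using assms extreme_point_of_convex_hull
  by (auto simp: lattice_polytope_def polytope_convex_hull)

lemma polar_convex_hull: "polar (convex hull V) = {y. \<forall>v\<in>V. y \<bullet> v \<le> 1}"
proof -
  have "convex hull V \<subseteq> {x. y \<bullet> x \<le> 1}" if "\<forall>v\<in>V. y \<bullet> v \<le> 1" for y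
    using that by (intro hull_minimal convex_halfspace_le) auto
  then show ?thesis
    unfolding polar_def using hull_subset[of V convex] by blast
qed

lemma Delta1_reflexive:
  fixes q :: "int ^ 'n"
  assumes q: "\<And>i. 0 < q $ i" and N: "N = 1 + (\<Sum>i\<in>UNIV. q $ i)"
    and dvd: "\<And>i. q $ i dvd N"
  shows "reflexive_polytope (Delta1 q)"
proof -
  have N0: "0 < N" unfolding N using q by (smt (verit) sum_nonneg)
  let ?e = "(\<chi> i. 1) :: real ^ 'n"
  \<comment> \<open>The point \<open>w i\<close> makes the inequality from \<open>-q\<close> tight,
    and also \<open>y_j <= 1\<close> for all \<open>j\<close> other than \<open>i\<close>. The
    quotient is exact by \<open>dvd\<close>.\<close>
  define w where "w i = ?e - axis i (of_int (N div q $ i))" for i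
  have "lattice_polytope (Delta1 q)"
    unfolding Delta1_def
    by (rule lattice_polytope_convex_hull) (auto simp: integer_lattice_def axis_def)
  moreover have "polar (Delta1 q) = convex hull (insert ?e (range w))"
  proof -
    have iff: "y \<in> polar (Delta1 q) \<longleftrightarrow>
      - (\<Sum>i\<in>UNIV. y $ i * of_int (q $ i)) \<le> 1 \<and> (\<forall>i. y $ i \<le> 1)" for y
      by (auto simp: Delta1_def polar_convex_hull inner_axis inner_vec_def[of _ "vec_lambda _"])
    have qN: "real_of_int (N div q $ i) * of_int (q $ i) = of_int N" for i
      using dvd[of i] by (metis dvd_div_mult_self of_int_mult)
    have "convex (polar (Delta1 q))"
      unfolding polar_def
      by (auto simp: convex_halfspace_le inner_commute[of _ "_::real^'n"] intro!: convex_INT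
          simp: Collect_ball_eq)
    moreover have "?e \<in> polar (Delta1 q)"
    proof -
      have "0 \<le> (\<Sum>i\<in>UNIV. real_of_int (q $ i))"
        using q by (intro sum_nonneg) (simp add: less_imp_le)
      then show ?thesis by (simp add: iff)
    qed
    moreover have "w i \<in> polar (Delta1 q)" for i
    proof -
      have "w i $ j * of_int (q $ j) = of_int (q $ j) - (if j = i then of_int N else 0)" for j
        using qN[of i] by (simp add: w_def axis_def left_diff_distrib)
      then have "(\<Sum>j\<in>UNIV. w i $ j * of_int (q $ j)) = (\<Sum>j\<in>UNIV. of_int (q $ j)) - of_int N"
        by (simp add: sum_subtractf)
      also have "\<dots> = - 1" by (simp add: N)
      finally have "(\<Sum>j\<in>UNIV. w i $ j * of_int (q $ j)) = - 1" .
      moreover have "0 \<le> N div q $ i" using N0 q[of i] by (simp add: pos_imp_zdiv_nonneg_iff)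
      ultimately show ?thesis by (auto simp: iff w_def axis_def)
    qed
    moreover have "y \<in> convex hull (insert ?e (range w))" if "y \<in> polar (Delta1 q)" for y
    proof -
      \<comment> \<open>The slack in \<open>y_i <= 1\<close>, scaled to be 1 at \<open>w i\<close>.
        It vanishes at \<open>?e\<close> and at the other \<open>w j\<close>, so it is the
        barycentric weight at \<open>w i\<close>.\<close>
      define b where "b i = (1 - y $ i) * of_int (q $ i) / of_int N" for i
      define a where "a = 1 - (\<Sum>i\<in>UNIV. b i)"
      have "(\<Sum>i\<in>UNIV. b i) = (of_int N - 1 - (\<Sum>i\<in>UNIV. y $ i * of_int (q $ i))) / of_int N"
        by (simp add: b_def N left_diff_distrib sum_subtractf flip: sum_divide_distrib)
      also have "\<dots> \<le> 1" using that N0 by (simp add: iff divide_le_eq)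
      finally have "0 \<le> a" by (simp add: a_def)
      moreover have "0 \<le> b i" for i
        using that N0 q[of i] by (simp add: b_def iff)
      ultimately have "a *\<^sub>R ?e + (\<Sum>i\<in>UNIV. b i *\<^sub>R w i) \<in> convex hull (insert ?e (range w))"
        by (intro convex_hull_insert_rangeI) (auto simp: a_def)
      moreover have "a *\<^sub>R ?e + (\<Sum>i\<in>UNIV. b i *\<^sub>R w i) = y"
      proof -
        have "b i * of_int (N div q $ i) = 1 - y $ i" for i
          using qN[of i] N0 by (simp add: b_def field_simps)
        then have "b j * w j $ i = b j - (if j = i then 1 - y $ i else 0)" for i j
          by (simp add: w_def axis_def right_diff_distrib)
        then show ?thesis
          by (simp add: vec_eq_iff a_def sum_subtractf)
      qed
      ultimately show ?thesis by simp
    qed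
    ultimately show ?thesis by (intro equalityI hull_minimal subsetI) auto
  qed
  moreover have "lattice_polytope (convex hull (insert ?e (range w)))"
    by (rule lattice_polytope_convex_hull) (auto simp: integer_lattice_def w_def axis_def)
  ultimately show ?thesis by (simp add: reflexive_polytope_def)
qed

subsection \<open>The Ehrhart series\<close>

text \<open>Weak compositions of \<open>m\<close> with parts indexed by \<open>A\<close>. Extension
  by 0 makes \<open>compositions A m\<close> a subset of
  \<open>compositions (insert a A) m\<close>.\<close>

definition compositions :: "'a set \<Rightarrow> nat \<Rightarrow> ('a \<Rightarrow> nat) set" where
  "compositions A m = {f. (\<forall>x. x \<notin> A \<longrightarrow> f x = 0) \<and> sum f A = m}"

lemma compositions_insert_0:
  assumes "finite A" "a \<notin> A"
  shows "compositions (insert a A) 0 = compositions A 0"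
  using assms by (auto simp: compositions_def) metis

text \<open>Either the part at \<open>a\<close> is 0 or one unit can be taken from it.\<close>

lemma compositions_insert_Suc:
  assumes "finite A" "a \<notin> A"
  shows "compositions (insert a A) (Suc m) =
    compositions A (Suc m) \<union> (\<lambda>f. f(a := Suc (f a))) ` compositions (insert a A) m"
proof (intro equalityI subsetI)
  have upd: "(\<Sum>x\<in>A. if x = a then y else f x) = sum f A" for f :: "'a \<Rightarrow> nat" and y
    using assms(2) by (intro sum.cong) auto
  fix f
  show "f \<in> compositions (insert a A) (Suc m)"
    if "f \<in> compositions A (Suc m) \<union> (\<lambda>f. f(a := Suc (f a))) ` compositions (insert a A) m"
    using that assms by (auto simp: compositions_def upd)
  assume f: "f \<in> compositions (insert a A) (Suc m)"
  show "f \<in> compositions A (Suc m) \<union> (\<lambda>f. f(a := Suc (f a))) ` compositions (insert a A) m"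
  proof (cases "f a")
    case 0
    with f assms show ?thesis by (auto simp: compositions_def) metis
  next
    case (Suc k)
    have "f(a := k) \<in> compositions (insert a A) m"
      using f Suc assms by (auto simp: compositions_def upd)
    moreover have "f = (f(a := k))(a := Suc ((f(a := k)) a))"
      using Suc by auto
    ultimately show ?thesis by blast
  qed
qed

lemma finite_compositions: "finite A \<Longrightarrow> finite (compositions A m)"
proof (induction A arbitrary: m rule: finite_induct)
  case empty
  have "compositions {} m \<subseteq> {\<lambda>_. 0}" by (auto simp: compositions_def)
  then show ?case by (rule finite_subset) simp
next
  case (insert a A)
  show ?case
    by (induction m) (simp_all add: insert compositions_insert_0 compositions_insert_Suc)
qed

lemma card_compositions_insert_Suc:
  assumes "finite A" "a \<notin> A"
  shows "card (compositions (insert a A) (Suc m)) =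
    card (compositions A (Suc m)) + card (compositions (insert a A) m)"
proof -
  let ?u = "\<lambda>f. f(a := Suc (f a))"
  have "inj ?u"
  proof (rule injI, rule ext)
    fix f g x assume eq: "?u f = ?u g"
    show "f x = g x"
      using fun_cong[OF eq, of x] by (simp split: if_splits)
  qed
  from inj_on_subset[OF this subset_UNIV]
  have "card (?u ` compositions (insert a A) m) = card (compositions (insert a A) m)"
    by (rule card_image)
  moreover have "compositions A (Suc m) \<inter> ?u ` compositions (insert a A) m = {}"
    using assms(2) by (auto simp: compositions_def)
  ultimately show ?thesis
    using assms by (simp add: compositions_insert_Suc card_Un_disjoint finite_compositions)
qed

text \<open>By the recurrence, multiplication by \<open>1 - fps_X\<close> removes one index from
  \<open>A\<close>.\<close>

lemma compositions_fps:
  assumes "finite A"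
  shows "Abs_fps (\<lambda>m. int (card (compositions A m))) * (1 - fps_X) ^ card A = 1"
  using assms
proof (induction A rule: finite_induct)
  case empty
  have "compositions ({} :: 'a set) 0 = {\<lambda>_. 0}" "compositions ({} :: 'a set) (Suc m) = {}" for m
    by (auto simp: compositions_def)
  then have "card (compositions ({} :: 'a set) m) = (if m = 0 then 1 else 0)" for m
    by (cases m) simp_all
  then show ?case by (simp add: fps_eq_iff)
next
  case (insert a A)
  let ?F = "\<lambda>A. Abs_fps (\<lambda>m. int (card (compositions A m)))"
  have "?F (insert a A) * (1 - fps_X) = ?F A"
  proof (rule fps_ext)
    fix m
    show "fps_nth (?F (insert a A) * (1 - fps_X)) m = fps_nth (?F A) m"
      using insert(1,2)
      by (cases m) (simp_all add: algebra_simps compositions_insert_0 card_compositions_insert_Suc)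
  qed
  with insert show ?case by (simp add: mult.assoc[symmetric])
qed

text \<open>For positive \<open>q\<close> and \<open>s >= 0\<close> this is the least
  \<open>t\<close> such that the \<open>t\<close>-th dilate has a lattice point with
  \<open>t - sum x = s\<close>: such a point satisfies \<open>x_i >= -floor(q_i s / N)\<close>, and
  equality is attainable.\<close>

definition height :: "int ^ 'n \<Rightarrow> int \<Rightarrow> int" where
  "height q s = s - (\<Sum>i\<in>UNIV. (q $ i * s) div (1 + (\<Sum>j\<in>UNIV. q $ j)))"

section \<open>Lattice points of the dilates, sorted by height\<close>

context
  fixes q :: "int ^ 'n" and N :: int
  assumes q: "\<And>i. 0 < q $ i" and N: "N = 1 + (\<Sum>i\<in>UNIV. q $ i)"
begin

lemma N_pos: "0 < N"
  unfolding N using q by (smt (verit) sum_nonneg)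

text \<open>Each floor grows by \<open>q_i * r\<close>, and all of them together by
  \<open>(N - 1) * r\<close>.\<close>

lemma height_add_period: "height q (s + N * r) = height q s + r"
proof -
  have "(q $ i * (s + N * r)) div N = (q $ i * s) div N + q $ i * r" for i
    using N_pos by (simp add: algebra_simps)
  then show ?thesis
    by (simp add: height_def N[symmetric] sum.distrib flip: sum_distrib_right)
      (simp add: N algebra_simps)
qed

text \<open>Expressing the floors by remainders shows that \<open>N * height q s\<close> exceeds
  \<open>s\<close> by the sum of the \<open>q_i * s mod N\<close>, each between 0 and
  \<open>N - 1\<close>.\<close>

lemma height_bounds:
  "s \<le> N * height q s" "N * height q s \<le> s + int CARD('n) * (N - 1)"
proof -
  have "N * height q s = N * s - (\<Sum>i\<in>UNIV. q $ i * s - (q $ i * s) mod N)"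
    by (simp add: height_def N[symmetric] right_diff_distrib sum_distrib_left minus_mod_eq_mult_div)
  also have "\<dots> = N * s - (N - 1) * s + (\<Sum>i\<in>UNIV. (q $ i * s) mod N)"
    by (simp add: sum_subtractf N sum_distrib_right)
  also have "\<dots> = s + (\<Sum>i\<in>UNIV. (q $ i * s) mod N)"
    by (simp add: algebra_simps)
  finally have eq: "N * height q s = s + (\<Sum>i\<in>UNIV. (q $ i * s) mod N)" .
  show "s \<le> N * height q s"
    unfolding eq using N_pos by (simp add: sum_nonneg)
  have "(\<Sum>i\<in>UNIV. (q $ i * s) mod N) \<le> of_nat (card (UNIV :: 'n set)) * (N - 1)"
    using N_pos by (intro sum_bounded_above) simp
  then show "N * height q s \<le> s + int CARD('n) * (N - 1)"
    unfolding eq by simp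
qed

lemma height_nonneg: "0 \<le> s \<Longrightarrow> 0 \<le> height q s"
  using height_bounds(1)[of s] N_pos by (smt (verit) zero_le_mult_iff)

lemma height_le:
  assumes "s < N" shows "height q s \<le> int CARD('n)"
proof -
  have "N * height q s < N * (int CARD('n) + 1)"
    using height_bounds(2)[of s] assms by (simp add: algebra_simps)
  then show ?thesis using N_pos by simp
qed

text \<open>A lattice point \<open>z\<close> is recorded by its slack \<open>s = t - sum z\<close>
  and the naturals \<open>z_i + floor(q_i s / N)\<close>. Writing \<open>s = b + N * f None\<close>
  with \<open>b < N\<close> turns the quotient into one more free part, because
  \<open>height q s = height q b + f None\<close>.\<close>

lemma card_lattice_points:
  "card ((*\<^sub>R) (real t) ` Delta1 q \<inter> integer_lattice) =
    (\<Sum>b<nat N. card {f :: 'n option \<Rightarrow> nat. sum f UNIV + nat (height q (int b)) = t})"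
proof -
  define B where "B = {z :: int ^ 'n. (\<Sum>i\<in>UNIV. z $ i) \<le> int t \<and>
    (\<forall>i. 0 \<le> N * z $ i + (int t - (\<Sum>j\<in>UNIV. z $ j)) * q $ i)}"
  define A where "A = (SIGMA b:{..<nat N}.
    {f :: 'n option \<Rightarrow> nat. sum f UNIV + nat (height q (int b)) = t})"
  let ?r = "\<lambda>z :: int ^ 'n. (\<chi> i. real_of_int (z $ i))"
  have r_iff: "?r z \<in> (*\<^sub>R) (real t) ` Delta1 q \<longleftrightarrow> z \<in> B" for z
  proof -
    have 1: "(\<Sum>i\<in>UNIV. ?r z $ i) \<le> real t \<longleftrightarrow> (\<Sum>i\<in>UNIV. z $ i) \<le> int t"
      by (simp flip: of_int_sum) linarith
    have "of_int N * ?r z $ i + (real t - (\<Sum>j\<in>UNIV. ?r z $ j)) * of_int (q $ i) =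
      of_int (N * z $ i + (int t - (\<Sum>j\<in>UNIV. z $ j)) * q $ i)" for i
      by simp
    then have 2: "0 \<le> of_int N * ?r z $ i + (real t - (\<Sum>j\<in>UNIV. ?r z $ j)) * of_int (q $ i) \<longleftrightarrow>
      0 \<le> N * z $ i + (int t - (\<Sum>j\<in>UNIV. z $ j)) * q $ i" for i
      by (metis of_int_0_le_iff)
    show ?thesis
      unfolding scaled_Delta1_iff[OF q N of_nat_0_le_iff] B_def 1 2 by simp
  qed
  have "(*\<^sub>R) (real t) ` Delta1 q \<inter> integer_lattice = ?r ` B"
  proof (intro equalityI subsetI)
    fix x assume x: "x \<in> (*\<^sub>R) (real t) ` Delta1 q \<inter> integer_lattice"
    then have "x = ?r (\<chi> i. \<lfloor>x $ i\<rfloor>)"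
      by (simp add: integer_lattice_def vec_eq_iff)
    with x show "x \<in> ?r ` B" using r_iff by (metis IntD1 imageI)
  next
    fix x assume "x \<in> ?r ` B"
    then obtain z where z: "z \<in> B" "x = ?r z" by auto
    moreover have "?r z \<in> integer_lattice" by (simp add: integer_lattice_def)
    ultimately show "x \<in> (*\<^sub>R) (real t) ` Delta1 q \<inter> integer_lattice"
      using r_iff[of z] by simp
  qed
  moreover have "inj_on ?r B"
    by (rule inj_onI) (simp add: vec_eq_iff)
  ultimately have "card ((*\<^sub>R) (real t) ` Delta1 q \<inter> integer_lattice) = card B"
    by (simp add: card_image)
  also have "card B = card A"
  proof -
    define g where "g = (\<lambda>(b, f :: 'n option \<Rightarrow> nat).
      \<chi> i. int (f (Some i)) - (q $ i * (int b + N * int (f None))) div N)"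
    define slack where "slack z = int t - (\<Sum>i\<in>UNIV. z $ i)" for z :: "int ^ 'n"
    define h where "h z = (nat (slack z mod N),
      case_option (nat (slack z div N)) (\<lambda>i. nat (z $ i + (q $ i * slack z) div N)))" for z
    \<comment> \<open>The floors subtracted in \<open>g\<close> add up to
      \<open>?s - height q ?s\<close>. Since \<open>height q ?s = height q b + f None\<close>, the
      sum condition in \<open>A\<close> leaves exactly \<open>?s\<close>.\<close>
    have slack_g: "slack (g (b, f)) = int b + N * int (f None)" if "(b, f) \<in> A" for b f
    proof -
      let ?s = "int b + N * int (f None)"
      have t: "int t = int (f None) + (\<Sum>i\<in>UNIV. int (f (Some i))) + height q (int b)"
        using that height_nonneg[of "int b"] by (auto simp: A_def sum_option)
      have "(\<Sum>i\<in>UNIV. g (b, f) $ i) = (\<Sum>i\<in>UNIV. int (f (Some i))) - (?s - height q ?s)"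
        by (simp add: g_def height_def N sum_subtractf)
      then show ?thesis unfolding slack_def t by (simp add: height_add_period)
    qed
    have "bij_betw g A B"
    proof (rule bij_betw_byWitness[where f' = h])
      show "\<forall>a\<in>A. h (g a) = a"
      proof (clarify)
        fix b f assume A: "(b, f) \<in> A"
        then have "b < nat N" by (simp add: A_def)
        then have "int b < N" by linarith
        then have "slack (g (b, f)) mod N = int b" "slack (g (b, f)) div N = int (f None)"
          using N_pos by (simp_all add: slack_g[OF A])
        moreover have "g (b, f) $ i + (q $ i * slack (g (b, f))) div N = int (f (Some i))" for i
          by (simp only: slack_g[OF A]) (simp add: g_def)
        ultimately show "h (g (b, f)) = (b, f)"
          by (auto simp: h_def fun_eq_iff split: option.split)
      qed
      \<comment> \<open>Nonnegativity survives division by \<open>N\<close> with rounding down, and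
        \<open>N * z_i\<close> divides exactly.\<close>
      have key: "0 \<le> slack z" "0 \<le> z $ i + (q $ i * slack z) div N" if "z \<in> B" for z i
      proof -
        have "0 \<le> N * z $ i + slack z * q $ i"
          using that by (simp add: B_def slack_def)
        then have "0 \<le> (N * z $ i + slack z * q $ i) div N"
          using N_pos by (simp only: pos_imp_zdiv_nonneg_iff)
        also have "(N * z $ i + slack z * q $ i) div N = z $ i + (q $ i * slack z) div N"
          using N_pos by (simp add: mult.commute)
        finally show "0 \<le> z $ i + (q $ i * slack z) div N" .
        show "0 \<le> slack z" using that by (simp add: B_def slack_def)
      qed
      show "\<forall>z\<in>B. g (h z) = z"
        using N_pos by (auto simp: g_def h_def vec_eq_iff key pos_imp_zdiv_nonneg_iff)
      show "g ` A \<subseteq> B"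
      proof clarify
        fix b f assume A: "(b, f) \<in> A"
        let ?s = "slack (g (b, f))"
        have "N * g (b, f) $ i + ?s * q $ i = N * int (f (Some i)) + (q $ i * ?s) mod N" for i
          by (simp only: slack_g[OF A])
            (simp add: g_def right_diff_distrib minus_div_mult_eq_mod[symmetric] mult.commute)
        moreover have "0 \<le> ?s" using N_pos by (simp add: slack_g[OF A])
        then have "(\<Sum>i\<in>UNIV. g (b, f) $ i) \<le> int t" by (simp add: slack_def)
        ultimately show "g (b, f) \<in> B"
          using N_pos by (simp add: B_def slack_def[symmetric])
      qed
      show "h ` B \<subseteq> A"
      proof clarify
        fix z b f assume z: "z \<in> B" and h: "(b, f) = h z"
        have b: "int b = slack z mod N" and f0: "int (f None) = slack z div N"
          and f: "\<And>i. int (f (Some i)) = z $ i + (q $ i * slack z) div N"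
          using h key[OF z] N_pos by (auto simp: h_def pos_imp_zdiv_nonneg_iff)
        have "height q (slack z) = height q (int b) + int (f None)"
          by (simp flip: height_add_period add: b f0)
        moreover have "(\<Sum>i\<in>UNIV. int (f (Some i))) = int t - height q (slack z)"
          by (simp add: f sum.distrib height_def N slack_def)
        ultimately have "int (sum f UNIV) + height q (int b) = int t"
          by (simp add: sum_option)
        then have "sum f UNIV + nat (height q (int b)) = t"
          using height_nonneg[of "int b"] by linarith
        moreover have "b < nat N" using pos_mod_bound[OF N_pos, of "slack z"] b by linarith
        ultimately show "(b, f) \<in> A" by (simp add: A_def)
      qed
    qed
    then show ?thesis by (simp add: bij_betw_same_card)
  qed
  also have "card A = (\<Sum>b<nat N. card {f :: 'n option \<Rightarrow> nat. sum f UNIV + nat (height q (int b)) = t})"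
    unfolding A_def
  proof (rule card_SigmaI)
    show "\<forall>b\<in>{..<nat N}. finite {f :: 'n option \<Rightarrow> nat. sum f UNIV + nat (height q (int b)) = t}"
    proof
      fix b
      have "{f :: 'n option \<Rightarrow> nat. sum f UNIV + nat (height q (int b)) = t} \<subseteq>
        compositions UNIV (t - nat (height q (int b)))"
        by (auto simp: compositions_def)
      then show "finite {f :: 'n option \<Rightarrow> nat. sum f UNIV + nat (height q (int b)) = t}"
        by (rule finite_subset) (simp add: finite_compositions)
    qed
  qed simp
  finally show ?thesis .
qed

text \<open>Each \<open>b\<close> contributes \<open>z^(height q b) / (1 - z)^(n+1)\<close>, the
  exponent \<open>n + 1\<close> being the size of \<open>'n option\<close>. The degree bound is
  \<open>height_le\<close>.\<close>

theorem Delta1_hstar: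
  "has_hstar_poly (Delta1 q) (\<Sum>b<nat N. monom 1 (nat (height q (int b))))"
proof -
  let ?F = "Abs_fps (\<lambda>m. int (card (compositions (UNIV :: 'n option set) m)))"
  have dim: "nat (aff_dim (Delta1 q)) = CARD('n)"
    using aff_dim_simplex[OF Delta1_simplex[OF q]] by simp
  have "ehrhart_series (Delta1 q) = (\<Sum>b<nat N. fps_X ^ nat (height q (int b)) * ?F)"
  proof (rule fps_ext)
    fix t
    have "int (card {f :: 'n option \<Rightarrow> nat. sum f UNIV + k = t}) = fps_nth (fps_X ^ k * ?F) t" for k
    proof (cases "k \<le> t")
      case True
      then have "{f :: 'n option \<Rightarrow> nat. sum f UNIV + k = t} = compositions UNIV (t - k)"
        by (auto simp: compositions_def)
      then show ?thesis using True by (simp add: fps_X_power_mult_nth)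
    next
      case False
      then have "{f :: 'n option \<Rightarrow> nat. sum f UNIV + k = t} = {}" by auto
      then show ?thesis using False by (simp only: fps_X_power_mult_nth) simp
    qed
    then show "fps_nth (ehrhart_series (Delta1 q)) t =
        fps_nth (\<Sum>b<nat N. fps_X ^ nat (height q (int b)) * ?F) t"
      by (simp add: ehrhart_series_def card_lattice_points fps_sum_nth)
  qed
  moreover have "?F * (1 - fps_X) ^ (CARD('n) + 1) = 1"
    using compositions_fps[of "UNIV :: 'n option set"] by (simp add: card_UNIV_option)
  ultimately have "ehrhart_series (Delta1 q) * (1 - fps_X) ^ (CARD('n) + 1) =
      (\<Sum>b<nat N. fps_X ^ nat (height q (int b)))"
    by (simp only: sum_distrib_right mult.assoc) simp
  moreover have "degree (\<Sum>b<nat N. monom (1::int) (nat (height q (int b)))) \<le> CARD('n)"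
    by (intro degree_sum_le order.trans[OF degree_monom_le]) (auto simp: nat_le_iff height_le)
  ultimately show ?thesis
    unfolding has_hstar_poly_def dim by (simp add: fps_of_poly_sum fps_of_poly_monom)
qed

end

subsection \<open>Factoradic digits\<close>

definition fac_div :: "nat \<Rightarrow> nat" where
  "fac_div i = fact (i + 1) + fact i"

lemma fac_div_eq: "fac_div i = fact i * (i + 2)"
  by (simp add: fac_div_def algebra_simps)

lemma fac_div_pos [simp]: "0 < fac_div i"
  by (simp add: fac_div_def)

lemma fac_div_neq_0 [simp]: "fac_div i \<noteq> 0"
  by (simp add: fac_div_def)

lemma strict_mono_fac_div: "strict_mono fac_div"
  by (rule strict_monoI_Suc) (simp add: fac_div_def)

lemma fac_div_dvd_fact:
  assumes "i < n" shows "fac_div i dvd fact (n + 1)"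
proof -
  have "fac_div i dvd fact (i + 2)"
    by (rule dvdI[of _ _ "i + 1"]) (simp add: fac_div_eq algebra_simps)
  also have "fact (i + 2) dvd (fact (n + 1) :: nat)"
    using assms by (intro fact_dvd) simp
  finally show ?thesis .
qed

text \<open>From \<open>n\<close> to \<open>n + 1\<close> the old quotients are multiplied by
  \<open>n + 2\<close> and the new one is \<open>n + 1\<close>, so the whole left side is multiplied
  by \<open>n + 2\<close>.\<close>

lemma sum_fact_div_fac_div: "1 + (\<Sum>i<n. fact (n + 1) div fac_div i) = fact (n + 1)"
proof (induction n)
  case (Suc n)
  have "fact (Suc n + 1) div fac_div i = (n + 2) * (fact (n + 1) div fac_div i)" if "i < n" for i
    using fac_div_dvd_fact[OF that] by (simp add: div_mult_swap)
  moreover have "fact (Suc n + 1) div fac_div n = n + 1"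
  proof -
    have "fact (Suc n + 1) = fac_div n * (n + 1)" by (simp add: fac_div_eq algebra_simps)
    then show ?thesis by (simp only: nonzero_mult_div_cancel_left fac_div_neq_0 not_False_eq_True)
  qed
  ultimately have "1 + (\<Sum>i<Suc n. fact (Suc n + 1) div fac_div i) =
      (n + 2) * (1 + (\<Sum>i<n. fact (n + 1) div fac_div i))"
    by (simp add: sum_distrib_left)
  also have "\<dots> = fact (Suc n + 1)" unfolding Suc by simp
  finally show ?case .
qed simp

text \<open>The reciprocals of the first \<open>n\<close> divisors add up to
  \<open>1 - 1 / (n+1)!\<close>. This keeps the natural subtraction in \<open>fac_height\<close>
  from being truncated.\<close>

lemma sum_div_fac_div_le: "(\<Sum>i<n. b div fac_div i) \<le> b"
proof -
  have "fact (n + 1) * (b div fac_div i) \<le> b * (fact (n + 1) div fac_div i)" if "i < n" for i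
  proof -
    have "fact (n + 1) * (b div fac_div i) =
        fac_div i * (b div fac_div i) * (fact (n + 1) div fac_div i)"
      using fac_div_dvd_fact[OF that] by (metis dvd_mult_div_cancel mult.assoc mult.commute)
    also have "\<dots> \<le> b * (fact (n + 1) div fac_div i)"
      by (intro mult_right_mono) simp_all
    finally show ?thesis .
  qed
  then have "fact (n + 1) * (\<Sum>i<n. b div fac_div i) \<le> b * (\<Sum>i<n. fact (n + 1) div fac_div i)"
    unfolding sum_distrib_left by (intro sum_mono) auto
  also have "\<dots> \<le> b * fact (n + 1)"
    using sum_fact_div_fac_div[of n] by (intro mult_left_mono) linarith+
  finally show ?thesis by (simp add: mult.commute)
qed

definition fac_height :: "nat \<Rightarrow> nat \<Rightarrow> nat" where
  "fac_height n b = b - (\<Sum>i<n. b div fac_div i)"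

text \<open>Because \<open>c * fac_div k = c * (k+1)! + c * k!\<close>, the quotient is
  \<open>c\<close> if \<open>c * k! <= e\<close> and \<open>c - 1\<close> otherwise; the bounds on
  \<open>c\<close> and \<open>e\<close> exclude other values.\<close>

lemma div_fac_div_leading_digit:
  assumes "c \<le> Suc k" "e < fact (Suc k)"
  shows "(c * fact (Suc k) + e) div fac_div k + (if e div fact k < c then 1 else 0) = c"
proof (cases "e div fact k < c")
  case False
  then have "c * fact k \<le> e" by (simp add: less_eq_div_iff_mult_less_eq not_less)
  then have "(c * fact (Suc k) + e) div fac_div k = c"
    using assms(2) by (intro div_nat_eqI) (auto simp: fac_div_def algebra_simps)
  with False show ?thesis by simp
next
  case True
  then obtain c0 where c: "c = Suc c0" by (cases c) auto
  have "e < Suc c0 * fact k" using True c by (simp add: div_less_iff_less_mult)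
  moreover have "c0 * fact k \<le> fact (Suc k)"
    using assms(1) c by (simp add: mult_le_mono1 trans_le_add2)
  ultimately have "(c * fact (Suc k) + e) div fac_div k = c0"
    unfolding c by (intro div_nat_eqI) (auto simp: fac_div_def algebra_simps)
  with True c show ?thesis by simp
qed

text \<open>For \<open>i < k\<close> the divisor \<open>fac_div i\<close> divides
  \<open>(k+1)!\<close>, so the digit \<open>c\<close> adds \<open>c * ((k+1)! - 1)\<close> to these
  quotients in total. What is left is \<open>c\<close> minus the quotient by
  \<open>fac_div k\<close>, which is \<open>c\<close> or \<open>c - 1\<close>.\<close>

lemma fac_height_Suc:
  assumes "c \<le> Suc k" "e < fact (Suc k)"
  shows "fac_height (Suc k) (c * fact (Suc k) + e) =
    fac_height k e + (if e div fact k < c then 1 else 0)"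
proof -
  define A :: nat where "A = fact (Suc k)"
  have "(c * A + e) div fac_div i = c * (A div fac_div i) + e div fac_div i" if i: "i < k" for i
  proof -
    obtain m where m: "A = fac_div i * m"
      using fac_div_dvd_fact[OF i] by (auto simp: A_def)
    then have "(c * A + e) div fac_div i = (e + fac_div i * (c * m)) div fac_div i"
      by (simp add: ac_simps)
    also have "\<dots> = c * m + e div fac_div i"
      by (rule div_mult_self2) simp
    finally show ?thesis using m by simp
  qed
  then have S: "(\<Sum>i<k. (c * A + e) div fac_div i) =
      c * (\<Sum>i<k. A div fac_div i) + (\<Sum>i<k. e div fac_div i)"
    by (simp add: sum.distrib sum_distrib_left)
  have "c + c * (\<Sum>i<k. A div fac_div i) = c * A"
    using arg_cong[OF sum_fact_div_fac_div[of k], of "\<lambda>x. c * x"]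
    by (simp add: A_def algebra_simps)
  then show ?thesis
    using div_fac_div_leading_digit[OF assms] sum_div_fac_div_le[where n = k and b = e] S
    unfolding fac_height_def A_def[symmetric] by (simp split: if_splits)
qed

text \<open>Serves both for the Lehmer digits of letters and for the positions of
  coordinates.\<close>

lemma bij_betw_rank:
  fixes S :: "'a::linorder set"
  assumes "finite S"
  shows "bij_betw (\<lambda>y. card {w \<in> S. w < y}) S {..<card S}"
proof -
  let ?r = "\<lambda>y. card {w \<in> S. w < y}"
  have less: "?r x < ?r y" if "x \<in> S" "x < y" for x y
    using assms that by (intro psubset_card_mono) auto
  have "inj_on ?r S"
  proof (rule inj_onI)
    fix x y assume "x \<in> S" "y \<in> S" "?r x = ?r y"
    then show "x = y" using less[of x y] less[of y x] by (cases x y rule: linorder_cases) auto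
  qed
  moreover have "?r ` S \<subseteq> {..<card S}"
    using assms by (auto intro!: psubset_card_mono)
  ultimately show ?thesis
    unfolding bij_betw_def by (intro conjI card_subset_eq) (simp_all add: card_image)
qed

subsection \<open>Descents and Lehmer codes\<close>

definition descents :: "nat list \<Rightarrow> nat" where
  "descents xs = (\<Sum>i<length xs - 1. if xs ! Suc i < xs ! i then 1 else 0)"

lemma descents_Nil [simp]: "descents [] = 0"
  by (simp add: descents_def)

lemma descents_singleton [simp]: "descents [x] = 0"
  by (simp add: descents_def)

lemma descents_Cons_Cons [simp]:
  "descents (x # y # xs) = (if y < x then 1 else 0) + descents (y # xs)"
  by (simp add: descents_def sum.lessThan_Suc_shift del: sum.lessThan_Suc)

lemma sum_permutations_of_set:
  assumes "finite S" "S \<noteq> {}"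
  shows "sum f (permutations_of_set S) = (\<Sum>y\<in>S. \<Sum>xs\<in>permutations_of_set (S - {y}). f (y # xs))"
proof -
  have "sum f (permutations_of_set S) =
      (\<Sum>y\<in>S. sum f ((\<lambda>xs. y # xs) ` permutations_of_set (S - {y})))"
    unfolding permutations_of_set_nonempty[OF assms(2)]
    using assms(1) by (intro sum.UNION_disjoint) auto
  also have "\<dots> = (\<Sum>y\<in>S. \<Sum>xs\<in>permutations_of_set (S - {y}). f (y # xs))"
    by (simp add: sum.reindex)
  finally show ?thesis .
qed

text \<open>The rank of \<open>x\<close> in \<open>S\<close> is the leading digit, and the rank of
  the next letter \<open>y\<close> is the digit after it. A descent \<open>y < x\<close> occurs
  exactly if the second digit is smaller, which is when \<open>fac_height_Suc\<close> adds
  1.\<close>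

lemma descents_generating_function:
  assumes "finite S" "x \<notin> S"
  shows "(\<Sum>xs\<in>permutations_of_set S. monom (1::int) (descents (x # xs))) =
    (\<Sum>b<fact (card S). monom 1 (fac_height (card S) (card {w \<in> S. w < x} * fact (card S) + b)))"
  using assms
proof (induction "card S" arbitrary: S x)
  case 0
  then show ?case by (simp add: fac_height_def)
next
  case (Suc k)
  let ?r = "\<lambda>x. card {w \<in> S. w < x}"
  let ?m = "\<lambda>n. monom (1::int) n"
  have card_S: "card S = Suc k" using Suc by simp
  have "S \<noteq> {}" using card_S by auto
  have r_less: "y < x \<longleftrightarrow> ?r y < ?r x" if "y \<in> S" for y
  proof
    assume "y < x"
    then show "?r y < ?r x" using that Suc(3) by (intro psubset_card_mono) auto
  next
    assume "?r y < ?r x"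
    moreover have "?r x \<le> ?r y" if "x \<le> y" using that Suc(3) by (intro card_mono) auto
    ultimately show "y < x" by force
  qed
  have r_le: "?r x \<le> Suc k"
    unfolding card_S[symmetric] using Suc(3) by (intro card_mono) auto
  have "(\<Sum>xs\<in>permutations_of_set S. ?m (descents (x # xs))) =
      (\<Sum>y\<in>S. \<Sum>xs\<in>permutations_of_set (S - {y}). ?m (descents (x # y # xs)))"
    using Suc(3) \<open>S \<noteq> {}\<close> by (rule sum_permutations_of_set)
  also have "\<dots> = (\<Sum>y\<in>S. \<Sum>b<fact k.
      ?m (if ?r y < ?r x then 1 else 0) * ?m (fac_height k (?r y * fact k + b)))"
  proof (rule sum.cong)
    fix y assume y: "y \<in> S"
    \<comment> \<open>Removing \<open>y\<close> leaves its rank unchanged, so the induction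
      hypothesis at \<open>y\<close> has the leading digit \<open>?r y\<close>.\<close>
    have "{w \<in> S - {y}. w < y} = {w \<in> S. w < y}" by auto
    moreover have "card (S - {y}) = k" using y card_S Suc(3) by simp
    ultimately have "(\<Sum>xs\<in>permutations_of_set (S - {y}). ?m (descents (y # xs))) =
        (\<Sum>b<fact k. ?m (fac_height k (?r y * fact k + b)))"
      using Suc(1)[of "S - {y}" y] Suc(3) by simp
    moreover have "(\<Sum>xs\<in>permutations_of_set (S - {y}). ?m (descents (x # y # xs))) =
        ?m (if ?r y < ?r x then 1 else 0) *
        (\<Sum>xs\<in>permutations_of_set (S - {y}). ?m (descents (y # xs)))"
      using r_less[OF y] by (simp add: sum_distrib_left mult_monom)
    ultimately show "(\<Sum>xs\<in>permutations_of_set (S - {y}). ?m (descents (x # y # xs))) =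
        (\<Sum>b<fact k. ?m (if ?r y < ?r x then 1 else 0) * ?m (fac_height k (?r y * fact k + b)))"
      by (simp only: sum_distrib_left)
  qed simp
  \<comment> \<open>The summand depends on \<open>y\<close> only through its rank.\<close>
  also have "\<dots> = (\<Sum>c<Suc k. \<Sum>b<fact k.
      ?m (if c < ?r x then 1 else 0) * ?m (fac_height k (c * fact k + b)))"
    using sum.reindex_bij_betw[OF bij_betw_rank[OF Suc(3)]] unfolding card_S by fast
  also have "\<dots> = (\<Sum>c<Suc k. \<Sum>b<fact k.
      ?m (fac_height (Suc k) (?r x * fact (Suc k) + (c * fact k + b))))"
  proof (intro sum.cong refl)
    fix c b :: nat assume c: "c \<in> {..<Suc k}" and b: "b \<in> {..<fact k}"
    have "c * fact k + b < c * fact k + fact k" using b by simp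
    also have "\<dots> = Suc c * fact k" by simp
    also have "\<dots> \<le> Suc k * fact k" using c by (intro mult_right_mono) auto
    finally have "c * fact k + b < fact (Suc k)" by simp
    moreover have "(c * fact k + b) div fact k = c" using b by simp
    ultimately show "?m (if c < ?r x then 1 else 0) * ?m (fac_height k (c * fact k + b)) =
        ?m (fac_height (Suc k) (?r x * fact (Suc k) + (c * fact k + b)))"
      using fac_height_Suc[OF r_le, of "c * fact k + b"] by (simp add: mult_monom add.commute)
  qed
  \<comment> \<open>Consecutive blocks of length \<open>k!\<close> exhaust the numbers below
    \<open>(k+1)!\<close>.\<close>
  also have "\<dots> = (\<Sum>c<Suc k. \<Sum>e\<in>{c * fact k..<c * fact k + fact k}.
      ?m (fac_height (Suc k) (?r x * fact (Suc k) + e)))"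
    by (intro sum.cong refl sum.reindex_bij_witness[of _ "\<lambda>e. e - c * fact k" "\<lambda>b. c * fact k + b" for c])
      auto
  also have "\<dots> = (\<Sum>e<Suc k * fact k. ?m (fac_height (Suc k) (?r x * fact (Suc k) + e)))"
    by (rule sum.nat_group)
  finally show ?case by (simp add: card_S)
qed

section \<open>Permutations in one-line notation\<close>

lemma bij_betw_permutes_permutations_of_set:
  "bij_betw (\<lambda>\<pi>. map \<pi> [1..<Suc n]) {\<pi>. \<pi> permutes {1..n}} (permutations_of_set {1..n})"
proof -
  let ?f = "\<lambda>\<pi>. map \<pi> [1..<Suc n]"
  have "inj_on ?f {\<pi>. \<pi> permutes {1..n}}"
  proof (rule inj_onI, rule ext)
    fix \<pi> \<sigma> x
    assume perms: "\<pi> \<in> {\<pi>. \<pi> permutes {1..n}}" "\<sigma> \<in> {\<pi>. \<pi> permutes {1..n}}"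
      and eq: "?f \<pi> = ?f \<sigma>"
    show "\<pi> x = \<sigma> x"
    proof (cases "x \<in> {1..n}")
      case True
      then show ?thesis using eq by (auto simp: map_eq_conv simp del: upt_Suc)
    next
      case False
      then show ?thesis using perms by (simp add: permutes_not_in)
    qed
  qed
  moreover have "?f ` {\<pi>. \<pi> permutes {1..n}} \<subseteq> permutations_of_set {1..n}"
  proof clarify
    fix \<pi> assume \<pi>: "\<pi> permutes {1..n}"
    have "set [1..<Suc n] = {1..n}" by auto
    then show "?f \<pi> \<in> permutations_of_set {1..n}"
      using permutes_image[OF \<pi>] permutes_inj_on[OF \<pi>]
      by (intro permutations_of_setI) (simp_all only: set_map distinct_map distinct_upt)
  qed
  moreover have "card {\<pi>. \<pi> permutes {1..n}} = card (permutations_of_set {1..n})"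
    by (simp add: card_permutations)
  ultimately show ?thesis
    unfolding bij_betw_def by (intro conjI card_subset_eq) (simp_all only: card_image finite_permutations_of_set)
qed

lemma des_eq_descents: "des n \<pi> = descents (map \<pi> [1..<Suc n])"
proof -
  have "des n \<pi> = (\<Sum>i\<in>{1..<n}. if \<pi> (i + 1) < \<pi> i then 1 else 0)"
    by (simp add: des_def Des_def sum.If_cases Int_def)
  also have "\<dots> = (\<Sum>i<n - 1. if \<pi> (i + 2) < \<pi> (i + 1) then 1 else 0)"
    by (rule sum.reindex_bij_witness[of _ "\<lambda>i. i + 1" "\<lambda>i. i - 1"]) auto
  also have "\<dots> = descents (map \<pi> [1..<Suc n])"
    unfolding descents_def by (intro sum.cong) (auto simp del: upt_Suc)
  finally show ?thesis .
qed

lemma eulerian_poly_eq_fac_height: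
  "eulerian_poly n = (\<Sum>b<fact n. monom 1 (fac_height n b))"
proof -
  have "eulerian_poly n = (\<Sum>xs\<in>permutations_of_set {1..n}. monom 1 (descents xs))"
    unfolding eulerian_poly_def des_eq_descents
    using sum.reindex_bij_betw[OF bij_betw_permutes_permutations_of_set] by fast
  \<comment> \<open>A leading 0 creates no descent and has rank 0, so the leading digit
    vanishes.\<close>
  also have "\<dots> = (\<Sum>xs\<in>permutations_of_set {1..n}. monom 1 (descents (0 # xs)))"
  proof (rule sum.cong)
    fix xs :: "nat list"
    show "monom (1::int) (descents xs) = monom 1 (descents (0 # xs))"
      by (cases xs) simp_all
  qed simp
  also have "\<dots> = (\<Sum>b<fact n. monom 1 (fac_height n b))"
    using descents_generating_function[of "{1..n}" 0] by simp
  finally show ?thesis .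
qed

subsection \<open>The position of the last descent\<close>

text \<open>The first \<open>k\<close> letters are free and the others are then determined. The
  induction removes the first letter.\<close>

lemma card_sorted_drop:
  assumes "finite S" "k \<le> card S"
  shows "card {xs \<in> permutations_of_set S. sorted (drop k xs)} * fact (card S - k) = fact (card S)"
  using assms
proof (induction k arbitrary: S)
  case 0
  have "{xs \<in> permutations_of_set S. sorted xs} = {sorted_list_of_set S}"
    using 0(1) sorted_list_of_set.idem_if_sorted_distinct[symmetric]
    by (auto simp: permutations_of_set_def)
  then show ?case by simp
next
  case (Suc k)
  then obtain m where m: "card S = Suc m" by (cases "card S") auto
  then have "S \<noteq> {}" by auto
  let ?T = "\<lambda>y. {xs \<in> permutations_of_set (S - {y}). sorted (drop k xs)}"
  have "{xs \<in> permutations_of_set S. sorted (drop (Suc k) xs)} = (\<Union>y\<in>S. (\<lambda>xs. y # xs) ` ?T y)"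
    by (subst permutations_of_set_nonempty[OF \<open>S \<noteq> {}\<close>]) auto
  also have "card \<dots> = (\<Sum>y\<in>S. card ((\<lambda>xs. y # xs) ` ?T y))"
    using Suc(2) by (intro card_UN_disjoint) auto
  also have "\<dots> = (\<Sum>y\<in>S. card (?T y))"
    by (simp add: card_image)
  finally have "card {xs \<in> permutations_of_set S. sorted (drop (Suc k) xs)} * fact (card S - Suc k) =
      (\<Sum>y\<in>S. card (?T y) * fact (m - k))"
    by (simp add: m sum_distrib_right)
  also have "\<dots> = (\<Sum>y\<in>S. fact m)"
  proof (rule sum.cong)
    fix y assume "y \<in> S"
    then have "card (S - {y}) = m" using m Suc(2) by simp
    then show "card (?T y) * fact (m - k) = fact m"
      using Suc(1)[of "S - {y}"] Suc(2,3) m by simp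
  qed simp
  also have "\<dots> = fact (card S)" by (simp add: m)
  finally show ?case .
qed

text \<open>The default 0 of \<open>maxDes\<close> fits the empty descent set of \<open>id\<close>.
  For any other permutation the maximum is over a nonempty set, since the only increasing word is
  the sorted one.\<close>

lemma maxDes_le_iff:
  assumes \<pi>: "\<pi> permutes {1..n}"
  shows "maxDes n \<pi> \<le> k \<longleftrightarrow> sorted (drop k (map \<pi> [1..<Suc n]))"
proof -
  have fin: "finite (Des n \<pi>)" by (simp add: Des_def)
  have iff: "sorted (drop k (map \<pi> [1..<Suc n])) \<longleftrightarrow> (\<forall>i\<in>Des n \<pi>. i \<le> k)" for k
  proof -
    have "sorted (drop k (map \<pi> [1..<Suc n])) \<longleftrightarrow>
        (\<forall>i. Suc i < n - k \<longrightarrow> \<pi> (Suc (k + i)) \<le> \<pi> (Suc (Suc (k + i))))"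
      by (auto simp: sorted_iff_nth_Suc drop_map simp del: upt_Suc)
    also have "\<dots> \<longleftrightarrow> (\<forall>j. k < j \<and> j < n \<longrightarrow> \<pi> j \<le> \<pi> (Suc j))"
    proof safe
      fix j assume *: "\<forall>i. Suc i < n - k \<longrightarrow> \<pi> (Suc (k + i)) \<le> \<pi> (Suc (Suc (k + i)))"
        and j: "k < j" "j < n"
      obtain i where "j = Suc (k + i)" using j(1) less_imp_Suc_add by blast
      then show "\<pi> j \<le> \<pi> (Suc j)" using * j(2) by auto
    qed auto
    also have "\<dots> \<longleftrightarrow> (\<forall>i\<in>Des n \<pi>. i \<le> k)"
    proof safe
      fix i assume "\<forall>j. k < j \<and> j < n \<longrightarrow> \<pi> j \<le> \<pi> (Suc j)" and i: "i \<in> Des n \<pi>"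
      then have "\<not> (k < i \<and> i < n)" by (auto simp: Des_def not_le[symmetric])
      with i show "i \<le> k" by (auto simp: Des_def)
    next
      fix j assume *: "\<forall>i\<in>Des n \<pi>. i \<le> k" and j: "k < j" "j < n"
      then have "j \<notin> Des n \<pi>" by auto
      with j show "\<pi> j \<le> \<pi> (Suc j)" by (simp add: Des_def)
    qed
    finally show ?thesis .
  qed
  show ?thesis
  proof (cases "\<pi> = id")
    case True
    then have "Des n \<pi> = {}" by (auto simp: Des_def)
    then show ?thesis using True by (simp add: iff maxDes_def del: upt_Suc)
  next
    case False
    have "Des n \<pi> \<noteq> {}"
    proof
      assume "Des n \<pi> = {}"
      then have "sorted (map \<pi> [1..<Suc n])" using iff[of 0] by simp
      moreover have "map \<pi> [1..<Suc n] \<in> permutations_of_set {1..n}"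
        using bij_betw_apply[OF bij_betw_permutes_permutations_of_set] \<pi> by blast
      ultimately have "map \<pi> [1..<Suc n] = sorted_list_of_set {1..n}"
        using sorted_list_of_set.idem_if_sorted_distinct permutations_of_setD by metis
      also have "\<dots> = map id [1..<Suc n]"
        by (metis atLeastLessThanSuc_atLeastAtMost list.map_id sorted_list_of_set_range)
      finally have eq: "map \<pi> [1..<Suc n] = map id [1..<Suc n]" .
      have "\<pi> = id"
        by (rule inj_onD[OF bij_betw_imp_inj_on[OF bij_betw_permutes_permutations_of_set[of n]]])
          (simp_all only: eq mem_Collect_eq \<pi> permutes_id)
      with False show False by contradiction
    qed
    then show ?thesis unfolding maxDes_def iff using False fin by simp
  qed
qed

lemma card_maxDes_le:
  assumes "k \<le> n"
  shows "card {\<pi>. \<pi> permutes {1..n} \<and> maxDes n \<pi> \<le> k} * fact (n - k) = fact n"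
proof -
  have "bij_betw (\<lambda>\<pi>. map \<pi> [1..<Suc n]) {\<pi> \<in> {\<pi>. \<pi> permutes {1..n}}. maxDes n \<pi> \<le> k}
      {xs \<in> permutations_of_set {1..n}. sorted (drop k xs)}"
    by (rule bij_betw_Collect[OF bij_betw_permutes_permutations_of_set])
      (use maxDes_le_iff in blast)
  then have "card {\<pi>. \<pi> permutes {1..n} \<and> maxDes n \<pi> \<le> k} =
      card {xs \<in> permutations_of_set {1..n}. sorted (drop k xs)}"
    using bij_betw_same_card by fastforce
  then show ?thesis using card_sorted_drop[of "{1..n}" k] assms by simp
qed

text \<open>With \<open>M = n + 1\<close> and \<open>j = n - Suc k\<close>, the number is the
  difference of the counts \<open>M! / (j+1)!\<close> and \<open>M! / (j+2)!\<close>, that is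
  \<open>M! * (j+1) / (j+2)!\<close>, and \<open>(j+2)! = fac_div j * (j+1)\<close>.\<close>

lemma maxDes_number_mult_fac_div:
  assumes "k < n"
  shows "maxDes_number (n + 1) (Suc k) * int (fac_div (n - Suc k)) = fact (n + 1)"
proof -
  let ?M = "n + 1" and ?j = "n - Suc k"
  let ?L = "\<lambda>k. {\<pi>. \<pi> permutes {1..?M} \<and> maxDes ?M \<pi> \<le> k}"
  have "maxDes_number ?M (Suc k) = int (card {\<pi>. \<pi> permutes {1..?M} \<and> maxDes ?M \<pi> = Suc k})"
    by (simp add: maxDes_number_def maxDes_poly_def coeff_sum finite_permutations sum.If_cases Int_def)
  also have "{\<pi>. \<pi> permutes {1..?M} \<and> maxDes ?M \<pi> = Suc k} = ?L (Suc k) - ?L k"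
    by auto
  also have "int (card \<dots>) = int (card (?L (Suc k))) - int (card (?L k))"
  proof -
    have "finite (?L k)" for k
      by (rule finite_subset[OF _ finite_permutations[of "{1..?M}"]]) auto
    then show ?thesis
      by (subst card_Diff_subset) (auto intro!: of_nat_diff card_mono simp del: One_nat_def)
  qed
  finally have B: "maxDes_number ?M (Suc k) = int (card (?L (Suc k))) - int (card (?L k))" .
  have "?M - Suc k = Suc ?j" "?M - k = Suc (Suc ?j)" using assms by auto
  then have L: "card (?L (Suc k)) * fact (Suc ?j) = fact ?M"
      "card (?L k) * fact (Suc (Suc ?j)) = fact ?M"
    using card_maxDes_le[of "Suc k" ?M] card_maxDes_le[of k ?M] assms by simp_all
  have *: "int (card (?L (Suc k))) * fact (Suc ?j) = fact ?M"
    using arg_cong[OF L(1), of int] by (simp only: of_nat_mult of_nat_fact)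
  have **: "int (card (?L k)) * fact (Suc (Suc ?j)) = fact ?M"
    using arg_cong[OF L(2), of int] by (simp only: of_nat_mult of_nat_fact)
  \<comment> \<open>The factor \<open>1 + int j\<close> completes \<open>fac_div j\<close> to
    \<open>(j+2)!\<close>, which clears both denominators; it is cancelled at the end.\<close>
  have "(x - y) * int (fac_div j) * (1 + int j) =
      x * fact (Suc j) * (int j + 2) - y * fact (Suc (Suc j))" for x y :: int and j
    by (simp add: fac_div_eq algebra_simps)
  then have "maxDes_number ?M (Suc k) * int (fac_div ?j) * (1 + int ?j) =
      fact ?M * (int ?j + 2) - fact ?M"
    unfolding B by (simp only: * **)
  also have "\<dots> = fact ?M * (1 + int ?j)"
    by (simp only: ring_distribs)
  finally show ?thesis by simp
qed

subsection \<open>The factoradic simplex\<close>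

lemma coord_pos_eq_Suc_rank: "coord_pos i = Suc (card {j. j < i})"
proof -
  have "{..i} = insert i {j. j < i}" by auto
  then show ?thesis by (simp add: coord_pos_def)
qed

lemma rank_less_CARD: "card {j. j < i} < CARD('n)" for i :: "'n::{finite,linorder}"
  by (rule psubset_card_mono) auto

lemma maxDes_vector_mult_fac_div:
  "(maxDes_vector :: int ^ 'n::{finite,linorder}) $ i * int (fac_div (CARD('n) - coord_pos i)) =
    fact (CARD('n) + 1)"
  using maxDes_number_mult_fac_div[OF rank_less_CARD[of i]]
  by (simp add: maxDes_vector_def coord_pos_eq_Suc_rank)

lemma maxDes_vector_pos: "0 < (maxDes_vector :: int ^ 'n::{finite,linorder}) $ i"
  using maxDes_vector_mult_fac_div[of i] fact_gt_zero[of "CARD('n) + 1", where 'a = int]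
  by (smt (verit) mult_nonpos_nonneg of_nat_0_le_iff)

lemma maxDes_vector_eq_div:
  "(maxDes_vector :: int ^ 'n::{finite,linorder}) $ i =
    int (fact (CARD('n) + 1) div fac_div (CARD('n) - coord_pos i))"
proof -
  have "int (fact (CARD('n) + 1)) =
      (maxDes_vector :: int ^ 'n::{finite,linorder}) $ i * int (fac_div (CARD('n) - coord_pos i))"
    using maxDes_vector_mult_fac_div[of i] by (simp only: of_nat_fact)
  then show ?thesis
    by (simp only: zdiv_int) simp
qed

text \<open>Positions start at 1, so the differences run through the indices below
  \<open>CARD('n)\<close> in reverse order.\<close>

lemma sum_coord_pos:
  fixes f :: "nat \<Rightarrow> 'a::comm_monoid_add"
  shows "(\<Sum>i\<in>(UNIV :: 'n::{finite,linorder} set). f (CARD('n) - coord_pos i)) = (\<Sum>j<CARD('n). f j)"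
proof -
  have "bij_betw (\<lambda>i::'n. card {j. j < i}) UNIV {..<CARD('n)}"
    using bij_betw_rank[of "UNIV :: 'n set"] by simp
  from sum.reindex_bij_betw[OF this, of "\<lambda>k. f (CARD('n) - Suc k)"] show ?thesis
    by (simp add: coord_pos_eq_Suc_rank sum.nat_diff_reindex)
qed

lemma sum_maxDes_vector:
  "fact (CARD('n) + 1) = 1 + (\<Sum>i\<in>UNIV. (maxDes_vector :: int ^ 'n::{finite,linorder}) $ i)"
proof -
  have "(\<Sum>i\<in>UNIV. (maxDes_vector :: int ^ 'n::{finite,linorder}) $ i) =
      int (\<Sum>j<CARD('n). fact (CARD('n) + 1) div fac_div j)"
    unfolding maxDes_vector_eq_div of_nat_sum by (rule sum_coord_pos)
  then show ?thesis
    using arg_cong[OF sum_fact_div_fac_div[of "CARD('n)"], of int]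
    by (simp only: of_nat_add of_nat_fact of_nat_1)
qed

text \<open>With \<open>n = CARD('n)\<close>, \<open>fac_height\<close> uses \<open>n + 1\<close>
  divisors but \<open>q\<close> has only \<open>n\<close> entries. The extra quotient vanishes
  because \<open>b < (n+1)! < fac_div n\<close>.\<close>

lemma height_maxDes_vector:
  assumes "b < fact (CARD('n) + 1)"
  shows "nat (height (maxDes_vector :: int ^ 'n::{finite,linorder}) (int b)) = fac_height (CARD('n) + 1) b"
proof -
  let ?q = "maxDes_vector :: int ^ 'n::{finite,linorder}"
  have "(?q $ i * int b) div (1 + (\<Sum>j\<in>UNIV. ?q $ j)) =
      int (b div fac_div (CARD('n) - coord_pos i))" for i
    unfolding sum_maxDes_vector[symmetric] maxDes_vector_mult_fac_div[of i, symmetric]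
    using maxDes_vector_pos[of i] by (simp add: zdiv_int)
  then have "height ?q (int b) =
      int b - (\<Sum>i\<in>(UNIV :: 'n set). int (b div fac_div (CARD('n) - coord_pos i)))"
    by (simp add: height_def)
  also have "\<dots> = int b - (\<Sum>j<CARD('n). int (b div fac_div j))"
    by (simp only: sum_coord_pos[where f = "\<lambda>j. int (b div fac_div j)"])
  also have "b div fac_div (CARD('n)) = 0"
    using assms by (intro div_less) (simp add: fac_div_def)
  then have "int b - (\<Sum>j<CARD('n). int (b div fac_div j)) =
      int b - int (\<Sum>j<CARD('n) + 1. b div fac_div j)"
    by simp
  finally show ?thesis by (simp only: fac_height_def nat_minus_as_int)
qed

text \<open>The number \<open>n\<close> of the informal statement is \<open>CARD('n)\<close>, which
  is at least 1 because types are nonempty.\<close>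

theorem theorem3p5:
  fixes a d :: "nat \<Rightarrow> nat" and q :: "int ^ 'n::{finite,linorder}"
  defines "a \<equiv> (\<lambda>m. fact (m + 1))"
    and "d \<equiv> (\<lambda>m. fact (m + 1) + fact m)"
    and "q \<equiv> maxDes_vector"
  shows "numeral_system a \<and> divisor_system a d \<and>
    (\<forall>i. 0 < q $ i) \<and> mono (\<lambda>i. q $ i) \<and>
    int CARD('n) simplex Delta1 q \<and>
    reflexive_polytope (Delta1 q) \<and>
    has_hstar_poly (Delta1 q) (eulerian_poly (CARD('n) + 1))"
proof -
  have d: "d = fac_div" by (simp add: d_def fac_div_def fun_eq_iff)
  have N: "fact (CARD('n) + 1) = 1 + (\<Sum>i\<in>UNIV. q $ i)"
    unfolding q_def by (rule sum_maxDes_vector)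
  have q_pos: "0 < q $ i" for i
    unfolding q_def by (rule maxDes_vector_pos)
  have "numeral_system a"
    unfolding numeral_system_def a_def by (auto intro: strict_monoI_Suc)
  moreover have "divisor_system a d"
    unfolding divisor_system_def d a_def
    using strict_mono_fac_div fac_div_dvd_fact sum_fact_div_fac_div by simp
  moreover have "mono (\<lambda>i. q $ i)"
  proof (rule monoI)
    fix i j :: 'n assume "i \<le> j"
    then have "coord_pos i \<le> coord_pos j"
      unfolding coord_pos_def by (intro card_mono) auto
    \<comment> \<open>A later position belongs to a smaller divisor and hence to a larger
      entry.\<close>
    then have "fac_div (CARD('n) - coord_pos j) \<le> fac_div (CARD('n) - coord_pos i)"
      by (intro monoD[OF strict_mono_mono[OF strict_mono_fac_div]] diff_le_mono2)
    then show "q $ i \<le> q $ j"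
      unfolding q_def maxDes_vector_eq_div by (intro of_nat_mono div_le_mono2 fac_div_pos)
  qed
  moreover have "int CARD('n) simplex Delta1 q"
    by (rule Delta1_simplex[OF q_pos])
  moreover have "reflexive_polytope (Delta1 q)"
  proof (rule Delta1_reflexive[OF q_pos N])
    show "q $ i dvd fact (CARD('n) + 1)" for i
      unfolding q_def maxDes_vector_mult_fac_div[of i, symmetric] by simp
  qed
  moreover have "has_hstar_poly (Delta1 q) (eulerian_poly (CARD('n) + 1))"
  proof -
    have "nat (fact (CARD('n) + 1)) = (fact (CARD('n) + 1) :: nat)"
      by (metis nat_int of_nat_fact)
    moreover have "(\<Sum>b<fact (CARD('n) + 1). monom 1 (nat (height q (int b)))) =
        eulerian_poly (CARD('n) + 1)"
      unfolding eulerian_poly_eq_fac_height q_def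
      by (intro sum.cong refl) (simp only: lessThan_iff height_maxDes_vector)
    ultimately show ?thesis
      using Delta1_hstar[OF q_pos N] by (simp only:)
  qed
  ultimately show ?thesis using q_pos by blast
qed

end
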